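(* Let $G$ be a finite connected outerplanar graph. A set $S\subseteq V(G)$ is a determining set for $G$ if and only if both of the following hold: (1) for every block $B$ of $G$, the set $X_B=\{v\in V(B): S \text{ contains a vertex of a blockbranch of } B \text{ at } v\}$ is a block determining set for $B$; (2) for every cutvertex $v$ of $G$ and every isomorphism class of blockbranches at $v$, all but one of the blockbranches in that class contain a vertex of $S\setminus\{v\}$.
   Context: A set $S\subseteq V(G)$ is a determining set if the only automorphism of $G$ fixing every vertex of $S$ is the identity. Blocks are maximal connected subgraphs without cutvertices (in an outerplanar graph each block is $K_2$ or a $2$-connected outerplanar graph). A blockbranch at a cutvertex $v$ is the subgraph induced by $v$ together with the vertices of one connected component of $G-v$ (i.e. the subgraph corresponding to a branch at the $C$-vertex $v$ of the block-cutvertex tree). For a block $B$ and $v\in V(B)$, a blockbranch of $B$ at $v$ is either the trivial blockbranch consisting of the single vertex $v$, or (if $v$ is a cutvertex) a blockbranch at $v$ not containing $B$; thus $X_B$ consists of those $v\in V(B)$ such that $v\in S$ or some vertex of $S$ lies in a component of $G-v$ disjoint from $V(B)\setminus\{v\}$. Two blockbranches $H,K$ at $v$ are isomorphic if there is a graph isomorphism $H\to K$ sending $v$ to $v$. A block determining set for a block $B$ is a subset $U\subseteq V(B)$ such that every automorphism of $G$ fixing every vertex of $U$ also fixes every vertex of $B$.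
   Formalization: Block determining sets are taken with respect to only those automorphisms of G that map the block B onto itself; with all automorphisms of G the claim fails for the path a–v–b, S={a}, B={v,b}, where X_B={v} but swapping a and b moves b. *)

theory Defs
  imports "Graph_Theory.Digraph_Component" "HOL-Analysis.Analysis"
begin

text \<open>
  A finite simple graph is a \<open>graph\<close> of the digraph library: finite, loop-free, without parallel
  arcs, and symmetric, so that every undirected edge is a pair of opposite arcs.  For such graphs
  the strongly connected components are the connected components.
\<close>

subsection \<open>Outerplanarity\<close>

text \<open>
  The curves are indexed by two-element vertex sets, so the two arcs of an undirected edge share
  one curve.
\<close>

definition plane_drawing ::
  "('a, 'b) pre_digraph \<Rightarrow> ('a \<Rightarrow> complex) \<Rightarrow> ('a set \<Rightarrow> real \<Rightarrow> complex) \<Rightarrow> bool" where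
  "plane_drawing G p c \<longleftrightarrow>
     inj_on p (verts G) \<and>
     (\<forall>u v. u \<rightarrow>\<^bsub>G\<^esub> v \<longrightarrow>
        arc (c {u, v}) \<and>
        {pathstart (c {u, v}), pathfinish (c {u, v})} = {p u, p v} \<and>
        path_image (c {u, v}) \<inter> p ` verts G = {p u, p v}) \<and>
     (\<forall>u v x y. u \<rightarrow>\<^bsub>G\<^esub> v \<and> x \<rightarrow>\<^bsub>G\<^esub> y \<and> {u, v} \<noteq> {x, y} \<longrightarrow>
        path_image (c {u, v}) \<inter> path_image (c {x, y}) \<subseteq> p ` verts G)"

definition drawing_image ::
  "('a, 'b) pre_digraph \<Rightarrow> ('a \<Rightarrow> complex) \<Rightarrow> ('a set \<Rightarrow> real \<Rightarrow> complex) \<Rightarrow> complex set" where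
  "drawing_image G p c =
     p ` verts G \<union> \<Union> {path_image (c {u, v}) |u v. u \<rightarrow>\<^bsub>G\<^esub> v}"

text \<open>
  The drawing of a finite graph is compact, so \<open>outside\<close> of its image is the unbounded face.
\<close>

definition outerplanar :: "('a, 'b) pre_digraph \<Rightarrow> bool" where
  "outerplanar G \<longleftrightarrow>
     (\<exists>p c. plane_drawing G p c \<and>
            (\<forall>v \<in> verts G. p v \<in> frontier (outside (drawing_image G p c))))"

subsection \<open>Automorphisms and determining sets\<close>

definition graph_iso :: "('a \<Rightarrow> 'c) \<Rightarrow> ('a, 'b) pre_digraph \<Rightarrow> ('c, 'd) pre_digraph \<Rightarrow> bool" where
  "graph_iso f G H \<longleftrightarrow>
     bij_betw f (verts G) (verts H) \<and>
     (\<forall>u \<in> verts G. \<forall>v \<in> verts G. u \<rightarrow>\<^bsub>G\<^esub> v \<longleftrightarrow> f u \<rightarrow>\<^bsub>H\<^esub> f v)"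

abbreviation graph_aut :: "('a, 'b) pre_digraph \<Rightarrow> ('a \<Rightarrow> 'a) \<Rightarrow> bool" where
  "graph_aut G f \<equiv> graph_iso f G G"

definition determining_set :: "('a, 'b) pre_digraph \<Rightarrow> 'a set \<Rightarrow> bool" where
  "determining_set G S \<longleftrightarrow>
     S \<subseteq> verts G \<and>
     (\<forall>f. graph_aut G f \<and> (\<forall>s \<in> S. f s = s) \<longrightarrow> (\<forall>v \<in> verts G. f v = v))"

subsection \<open>Cutvertices, blocks and blockbranches\<close>

definition cutvertex :: "('a, 'b) pre_digraph \<Rightarrow> 'a \<Rightarrow> bool" where
  "cutvertex G v \<longleftrightarrow>
     v \<in> verts G \<and>
     (\<exists>x \<in> verts G - {v}. \<exists>y \<in> verts G - {v}.
        x \<rightarrow>\<^sup>*\<^bsub>G\<^esub> y \<and> \<not> x \<rightarrow>\<^sup>*\<^bsub>pre_digraph.del_vert G v\<^esub> y)"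

text \<open>
  The conjunct \<open>graph H\<close> excludes subdigraphs that contain only one of two opposite arcs.
\<close>

definition block :: "('a, 'b) pre_digraph \<Rightarrow> ('a, 'b) pre_digraph \<Rightarrow> bool" where
  "block G B \<longleftrightarrow>
     pre_digraph.max_subgraph G
       (\<lambda>H. graph H \<and> Digraph_Component.connected H \<and> (\<nexists>v. cutvertex H v)) B"

definition blockbranches :: "('a, 'b) pre_digraph \<Rightarrow> 'a \<Rightarrow> ('a, 'b) pre_digraph set" where
  "blockbranches G v =
     {G \<restriction> insert v C |C. C \<in> pre_digraph.sccs_verts (pre_digraph.del_vert G v)}"

definition branch_iso ::
  "('a, 'b) pre_digraph \<Rightarrow> 'a \<Rightarrow> (('a, 'b) pre_digraph \<times> ('a, 'b) pre_digraph) set" where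
  "branch_iso G v =
     {(H, K). H \<in> blockbranches G v \<and> K \<in> blockbranches G v \<and> (\<exists>f. graph_iso f H K \<and> f v = v)}"

definition blockbranches_of_block ::
  "('a, 'b) pre_digraph \<Rightarrow> ('a, 'b) pre_digraph \<Rightarrow> 'a \<Rightarrow> ('a, 'b) pre_digraph set" where
  "blockbranches_of_block G B v =
     insert (G \<restriction> {v}) {H \<in> blockbranches G v. cutvertex G v \<and> \<not> subgraph B H}"

definition X_set :: "('a, 'b) pre_digraph \<Rightarrow> 'a set \<Rightarrow> ('a, 'b) pre_digraph \<Rightarrow> 'a set" where
  "X_set G S B = {v \<in> verts B. \<exists>H \<in> blockbranches_of_block G B v. S \<inter> verts H \<noteq> {}}"

text \<open>
  Only automorphisms of \<open>G\<close> that map \<open>B\<close> onto itself, i.e. the symmetries of \<open>B\<close> induced by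
  \<open>G\<close>, are taken into account.  Quantifying over all automorphisms of \<open>G\<close> instead would refute
  the characterization of determining sets: in the path \<open>a - v - b\<close> the set \<open>{a}\<close> is determining,
  the block \<open>B\<close> with vertices \<open>v\<close>, \<open>b\<close> has \<open>X_set G {a} B = {v}\<close>, and the automorphism that
  exchanges \<open>a\<close> and \<open>b\<close> fixes \<open>v\<close> but not \<open>b\<close>.
\<close>

definition block_determining_set ::
  "('a, 'b) pre_digraph \<Rightarrow> ('a, 'b) pre_digraph \<Rightarrow> 'a set \<Rightarrow> bool" where
  "block_determining_set G B U \<longleftrightarrow>
     U \<subseteq> verts B \<and>
     (\<forall>f. graph_aut G f \<and> f ` verts B = verts B \<and> (\<forall>u \<in> U. f u = u) \<longrightarrow>
          (\<forall>b \<in> verts B. f b = b))"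

end

theory Submission
  imports Defs
begin

text \<open>
  Call a vertex set nonseparable if no single vertex separates two of its members; the blocks are
  the subgraphs induced by the maximal nonseparable sets.  The blockbranches of a block at its
  vertices partition the graph.

  If a determining set violated one of the conditions, then a nontrivial automorphism fixing it
  would arise either by replacing an automorphism that preserves a block by the identity on the
  blockbranches at its fixed vertices in \<open>X_set\<close>, or by exchanging two isomorphic blockbranches.

  Conversely, let an automorphism fix \<open>S\<close> pointwise.  The vertices of minimum eccentricity form an
  invariant nonseparable set, so some vertex is fixed or some block is invariant; an invariant
  block is fixed pointwise by the first condition.  At a fixed vertex all blockbranches, and hence
  all blocks containing it, are invariant by the second condition, so the fixed vertices are closed
  under adjacency.
\<close>

subsection \<open>Nonseparable sets\<close>

text \<open>The closure is taken over the whole vertex type, so the relation is reflexive even at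
  \<open>v\<close> itself, and no other pair involving \<open>v\<close> is related. For
  \<open>x\<close> in \<open>verts G - {v}\<close> it is reachability in \<open>del_vert v\<close>,
  without a change of graph.\<close>

definition linked_avoiding :: "('a, 'b) pre_digraph \<Rightarrow> 'a \<Rightarrow> 'a \<Rightarrow> 'a \<Rightarrow> bool" where
  "linked_avoiding G v = (\<lambda>a b. a \<rightarrow>\<^bsub>G\<^esub> b \<and> a \<noteq> v \<and> b \<noteq> v)\<^sup>*\<^sup>*"

text \<open>The separating \<open>v\<close> ranges over the whole type. In a connected graph only
  vertices matter, by \<open>linked_avoiding_outside\<close>; the ends of an edge always form such a
  set, so that bridges yield blocks too.\<close>

definition nonseparable :: "('a, 'b) pre_digraph \<Rightarrow> 'a set \<Rightarrow> bool" where
  "nonseparable G W \<longleftrightarrow> W \<subseteq> verts G \<and>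
     (\<forall>x\<in>W. \<forall>y\<in>W. \<forall>v. v \<noteq> x \<and> v \<noteq> y \<longrightarrow> linked_avoiding G v x y)"

definition block_verts :: "('a, 'b) pre_digraph \<Rightarrow> 'a set \<Rightarrow> bool" where
  "block_verts G W \<longleftrightarrow> W \<noteq> {} \<and> nonseparable G W \<and>
     (\<forall>W'. nonseparable G W' \<and> W \<subseteq> W' \<longrightarrow> W' = W)"

lemma linked_avoiding_refl [simp]: "linked_avoiding G v x x"
  by (simp add: linked_avoiding_def)

lemma linked_avoiding_trans [trans]:
  "linked_avoiding G v x y \<Longrightarrow> linked_avoiding G v y z \<Longrightarrow> linked_avoiding G v x z"
  by (simp add: linked_avoiding_def)

lemma linked_avoiding_step: "x \<rightarrow>\<^bsub>G\<^esub> y \<Longrightarrow> x \<noteq> v \<Longrightarrow> y \<noteq> v \<Longrightarrow> linked_avoiding G v x y"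
  by (auto simp: linked_avoiding_def)

lemma linked_avoiding_self_left [simp]: "linked_avoiding G v v y \<longleftrightarrow> y = v"
  unfolding linked_avoiding_def by (auto elim: converse_rtranclpE)

lemma linked_avoiding_self_right [simp]: "linked_avoiding G v x v \<longleftrightarrow> x = v"
  unfolding linked_avoiding_def by (auto elim: rtranclp.cases)

lemma linked_avoiding_mono:
  assumes "linked_avoiding H v x y" "\<And>a b. a \<rightarrow>\<^bsub>H\<^esub> b \<Longrightarrow> a \<rightarrow>\<^bsub>G\<^esub> b"
  shows "linked_avoiding G v x y"
  using assms unfolding linked_avoiding_def by (auto elim: rtranclp_mono[THEN predicate2D, rotated])

context wf_digraph begin

lemma reachable_conv_rtranclp:
  assumes "x \<in> verts G"
  shows "x \<rightarrow>\<^sup>* y \<longleftrightarrow> (\<lambda>a b. a \<rightarrow>\<^bsub>G\<^esub> b)\<^sup>*\<^sup>* x y"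
proof
  assume "x \<rightarrow>\<^sup>* y" then show "(\<lambda>a b. a \<rightarrow>\<^bsub>G\<^esub> b)\<^sup>*\<^sup>* x y"
    unfolding reachable_def by induct (auto intro: converse_rtranclp_into_rtranclp)
next
  assume "(\<lambda>a b. a \<rightarrow>\<^bsub>G\<^esub> b)\<^sup>*\<^sup>* x y" then show "x \<rightarrow>\<^sup>* y"
    by induct (auto intro: assms reachable_adj_trans)
qed

lemma linked_avoiding_in_verts:
  "linked_avoiding G v x y \<Longrightarrow> x \<in> verts G \<Longrightarrow> y \<in> verts G"
  unfolding linked_avoiding_def by (induct rule: rtranclp_induct) auto

lemma dominates_del_vert_iff: "a \<rightarrow>\<^bsub>del_vert v\<^esub> b \<longleftrightarrow> a \<rightarrow>\<^bsub>G\<^esub> b \<and> a \<noteq> v \<and> b \<noteq> v"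
  by (auto simp: del_vert_def arcs_ends_conv image_iff)

lemma reachable_del_vert_iff:
  assumes "x \<in> verts G - {v}"
  shows "x \<rightarrow>\<^sup>*\<^bsub>del_vert v\<^esub> y \<longleftrightarrow> linked_avoiding G v x y"
proof -
  interpret D: wf_digraph "del_vert v" by (rule wf_digraph_del_vert)
  show ?thesis
    using assms
    by (subst D.reachable_conv_rtranclp)
      (auto simp: dominates_del_vert_iff linked_avoiding_def verts_del_vert)
qed

lemma dominates_induce_iff: "a \<rightarrow>\<^bsub>G \<restriction> W\<^esub> b \<longleftrightarrow> a \<rightarrow>\<^bsub>G\<^esub> b \<and> a \<in> W \<and> b \<in> W"
  by (auto simp: arcs_ends_conv image_iff)

end

context graph begin

lemma linked_avoiding_sym: "linked_avoiding G v x y \<Longrightarrow> linked_avoiding G v y x"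
  unfolding linked_avoiding_def
  by (rule sympD[OF symp_rtranclp]) (auto intro!: sympI dest: graph_symmetric)

lemma connected_iff:
  "Digraph_Component.connected G \<longleftrightarrow>
     verts G \<noteq> {} \<and> (\<forall>x\<in>verts G. \<forall>y\<in>verts G. (\<lambda>a b. a \<rightarrow>\<^bsub>G\<^esub> b)\<^sup>*\<^sup>* x y)"
proof -
  have "(arcs_ends G)\<^sup>s = arcs_ends G"
    by (auto simp: symcl_def dest: graph_symmetric)
  then show ?thesis
    unfolding connected_conv
    by (simp add: reachable_def[symmetric] reachable_conv_rtranclp)
qed

lemma cutvertex_iff:
  assumes "Digraph_Component.connected G"
  shows "cutvertex G v \<longleftrightarrow>
    v \<in> verts G \<and> (\<exists>x\<in>verts G - {v}. \<exists>y\<in>verts G - {v}. \<not> linked_avoiding G v x y)"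
  using assms unfolding cutvertex_def
  by (auto simp: reachable_del_vert_iff reachable_conv_rtranclp connected_iff)

lemma block_verts_extension:
  assumes "nonseparable G C" "C \<noteq> {}"
  obtains W where "block_verts G W" "C \<subseteq> W"
proof -
  let ?\<F> = "{W. nonseparable G W \<and> C \<subseteq> W}"
  have "finite ?\<F>"
    by (rule finite_subset[of _ "Pow (verts G)"]) (auto simp: nonseparable_def)
  moreover have "C \<in> ?\<F>" using assms(1) by simp
  ultimately have "\<exists>W\<in>?\<F>. C \<subseteq> W \<and> (\<forall>W'\<in>?\<F>. W \<subseteq> W' \<longrightarrow> W = W')"
    by (rule finite_has_maximal2)
  then obtain W where W: "W \<in> ?\<F>" "\<forall>W'\<in>?\<F>. W \<subseteq> W' \<longrightarrow> W = W'"
    by (elim bexE conjE)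
  have "block_verts G W"
    unfolding block_verts_def
  proof (intro conjI allI impI)
    show "W \<noteq> {}" "nonseparable G W" using W(1) assms(2) by auto
    fix W' assume "nonseparable G W' \<and> W \<subseteq> W'"
    then show "W' = W" using W by auto
  qed
  with W(1) that show thesis by blast
qed

lemma nonseparable_edge:
  assumes "x \<rightarrow>\<^bsub>G\<^esub> y"
  shows "nonseparable G {x, y}"
  using assms unfolding nonseparable_def
  by (auto intro: linked_avoiding_step dest: graph_symmetric)

lemma nonseparableD:
  "nonseparable G W \<Longrightarrow> x \<in> W \<Longrightarrow> y \<in> W \<Longrightarrow> v \<noteq> x \<Longrightarrow> v \<noteq> y \<Longrightarrow> linked_avoiding G v x y"
  by (auto simp: nonseparable_def)

text \<open>The union of the two blocks is again nonseparable: a cut at \<open>t\<close> other than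
  \<open>v\<close> is bypassed through the common vertex \<open>v\<close>, and a cut at
  \<open>v\<close> is bypassed through the link from \<open>x\<close> to \<open>y\<close>.
  Maximality forces both blocks to equal the union. Taking \<open>x = y\<close> shows that distinct
  blocks share at most one vertex.\<close>

lemma block_verts_eqI:
  assumes "block_verts G W" "block_verts G W'" "v \<in> W" "v \<in> W'"
    and "x \<in> W - {v}" "y \<in> W' - {v}" "linked_avoiding G v x y"
  shows "W = W'"
proof -
  have ns: "nonseparable G W" "nonseparable G W'"
    using assms by (auto simp: block_verts_def)
  have cross: "linked_avoiding G t a b" if "a \<in> W" "b \<in> W'" "t \<noteq> a" "t \<noteq> b" for a b t
  proof (cases "t = v")
    case True
    have "linked_avoiding G v a x" "linked_avoiding G v y b"
      using nonseparableD[OF ns(1)] nonseparableD[OF ns(2)] that assms True by auto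
    with assms True show ?thesis by (metis linked_avoiding_trans)
  next
    case False
    then have "linked_avoiding G t a v" "linked_avoiding G t v b"
      using nonseparableD[OF ns(1)] nonseparableD[OF ns(2)] that assms by auto
    then show ?thesis by (rule linked_avoiding_trans)
  qed
  have "nonseparable G (W \<union> W')"
    unfolding nonseparable_def
  proof (intro conjI ballI allI impI)
    show "W \<union> W' \<subseteq> verts G" using ns by (auto simp: nonseparable_def)
  next
    fix a b t assume "a \<in> W \<union> W'" "b \<in> W \<union> W'" "t \<noteq> a \<and> t \<noteq> b"
    then show "linked_avoiding G t a b"
      using nonseparableD[OF ns(1)] nonseparableD[OF ns(2)] cross[of a b t] cross[of b a t]
        linked_avoiding_sym by auto
  qed
  then have "W \<union> W' = W" "W \<union> W' = W'"
    using assms(1,2) by (auto simp: block_verts_def)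
  then show ?thesis by simp
qed

text \<open>The edge from \<open>v\<close> to \<open>a\<close> lies in some block. A link from
  \<open>a\<close> to \<open>w\<close> off \<open>v\<close> would identify that block with
  \<open>W\<close> and so put \<open>a\<close> into \<open>W\<close>.\<close>

lemma not_linked_outside_block:
  assumes W: "block_verts G W" "v \<in> W" "a \<notin> W" "v \<rightarrow>\<^bsub>G\<^esub> a" "w \<in> W - {v}"
  shows "\<not> linked_avoiding G v a w"
proof
  assume l: "linked_avoiding G v a w"
  obtain W' where W': "block_verts G W'" "{v, a} \<subseteq> W'"
    using block_verts_extension[OF nonseparable_edge[OF W(4)]] by blast
  have "W = W'"
    using linked_avoiding_sym[OF l] W W' by (intro block_verts_eqI[of W W' v w a]) auto
  with W W' show False by simp
qed

end

section \<open>Decomposition of the graph along a block\<close>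

text \<open>For \<open>v \<in> W\<close> this is the union of the blockbranches at \<open>v\<close> of the block on \<open>W\<close>.\<close>

definition hanging :: "('a, 'b) pre_digraph \<Rightarrow> 'a set \<Rightarrow> 'a \<Rightarrow> 'a set" where
  "hanging G W v = {z \<in> verts G. \<forall>w\<in>W - {v}. \<not> linked_avoiding G v z w}"

context graph begin

lemma hanging_self: "v \<in> verts G \<Longrightarrow> v \<in> hanging G W v"
  by (auto simp: hanging_def)

lemma hanging_inter_block: "z \<in> hanging G W v \<Longrightarrow> z \<in> W \<Longrightarrow> z = v"
  by (force simp: hanging_def)

lemma hanging_step:
  assumes "z \<in> hanging G W v" "z \<rightarrow>\<^bsub>G\<^esub> z'" "z \<noteq> v" "z' \<noteq> v"
  shows "z' \<in> hanging G W v"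
  using assms linked_avoiding_step[OF assms(2-4)]
  unfolding hanging_def by (auto dest: linked_avoiding_trans)

lemma hanging_step_block:
  assumes "block_verts G W" "v \<in> W" "v \<rightarrow>\<^bsub>G\<^esub> a" "a \<notin> W"
  shows "a \<in> hanging G W v"
  using assms not_linked_outside_block[OF assms(1,2,4,3)] by (auto simp: hanging_def)

text \<open>The walk is projected to \<open>W\<close>: while it stays in the part hanging at
  \<open>v\<close> the projection rests at \<open>v\<close>, and that part can be left only through
  \<open>v\<close>. The predicate \<open>P\<close> lets the same induction serve for plain
  connectivity and for walks that avoid a vertex.\<close>

lemma walk_retract:
  assumes W: "block_verts G W" and x: "x \<in> W"
    and walk: "(\<lambda>a b. a \<rightarrow>\<^bsub>G\<^esub> b \<and> P a \<and> P b)\<^sup>*\<^sup>* x z"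
  shows "\<exists>v\<in>W. z \<in> hanging G W v \<and> (\<lambda>a b. a \<rightarrow>\<^bsub>G\<^esub> b \<and> P a \<and> P b \<and> a \<in> W \<and> b \<in> W)\<^sup>*\<^sup>* x v"
  using walk
proof (induct rule: rtranclp_induct)
  case base
  have "x \<in> verts G" using W x by (auto simp: block_verts_def nonseparable_def)
  then show ?case using x by (auto intro: hanging_self)
next
  case (step z z')
  then obtain v where v: "v \<in> W" "z \<in> hanging G W v"
    "(\<lambda>a b. a \<rightarrow>\<^bsub>G\<^esub> b \<and> P a \<and> P b \<and> a \<in> W \<and> b \<in> W)\<^sup>*\<^sup>* x v" by blast
  have z': "z' \<in> verts G" using step by auto
  consider "z' = v" | "z' \<noteq> v" "z \<noteq> v" | "z = v" "z' \<in> W" | "z = v" "z' \<notin> W" by blast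
  then show ?case
  proof cases
    case 1 then show ?thesis using v z' hanging_self by blast
  next
    case 2 then show ?thesis using hanging_step v step by blast
  next
    case 3
    then have "(\<lambda>a b. a \<rightarrow>\<^bsub>G\<^esub> b \<and> P a \<and> P b \<and> a \<in> W \<and> b \<in> W)\<^sup>*\<^sup>* x z'"
      using v step by (auto intro: rtranclp.rtrancl_into_rtrancl)
    then show ?thesis using 3 z' hanging_self by blast
  next
    case 4 then show ?thesis using hanging_step_block[OF W v(1)] v step by blast
  qed
qed

lemma walk_retract_block:
  assumes W: "block_verts G W" and "x \<in> W" "y \<in> W"
    and "(\<lambda>a b. a \<rightarrow>\<^bsub>G\<^esub> b \<and> P a \<and> P b)\<^sup>*\<^sup>* x y"
  shows "(\<lambda>a b. a \<rightarrow>\<^bsub>G\<^esub> b \<and> P a \<and> P b \<and> a \<in> W \<and> b \<in> W)\<^sup>*\<^sup>* x y"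
  using walk_retract[OF W assms(2,4)] assms(3) hanging_inter_block by blast

text \<open>The alternative depends on which of \<open>u\<close> and \<open>v\<close> the walk from
  \<open>s\<close> meets first. This is what makes the parts hanging at two vertices of a block
  disjoint.\<close>

lemma linked_avoiding_either:
  assumes "(\<lambda>a b. a \<rightarrow>\<^bsub>G\<^esub> b)\<^sup>*\<^sup>* s u" and "u \<noteq> v"
  shows "linked_avoiding G v s u \<or> linked_avoiding G u s v"
  using assms(1)
proof (induct rule: converse_rtranclp_induct)
  case base then show ?case by simp
next
  case (step s s')
  show ?case
  proof (cases "s = u \<or> s = v")
    case True then show ?thesis by auto
  next
    case False
    show ?thesis
    proof (cases "s' = u \<or> s' = v")
      case True
      then show ?thesis using step(1) False \<open>u \<noteq> v\<close>
        by (auto intro: linked_avoiding_step)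
    next
      case 2: False
      have "linked_avoiding G v s s'" "linked_avoiding G u s s'"
        using 2 False step(1) by (auto intro: linked_avoiding_step)
      then show ?thesis using step(3) by (auto dest: linked_avoiding_trans)
    qed
  qed
qed

end

section \<open>The retraction onto a block\<close>

locale connected_graph = graph +
  assumes conn: "Digraph_Component.connected G"
begin

lemma walk: "x \<in> verts G \<Longrightarrow> y \<in> verts G \<Longrightarrow> (\<lambda>a b. a \<rightarrow>\<^bsub>G\<^esub> b)\<^sup>*\<^sup>* x y"
  using conn connected_iff by blast

lemma linked_avoiding_outside:
  assumes "v \<notin> verts G" "x \<in> verts G" "y \<in> verts G"
  shows "linked_avoiding G v x y"
proof -
  have "(\<lambda>a b. a \<rightarrow>\<^bsub>G\<^esub> b \<and> a \<noteq> v \<and> b \<noteq> v) = dominates G"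
    using assms(1) by (intro ext) auto
  then show ?thesis using walk[OF assms(2,3)] by (simp add: linked_avoiding_def)
qed

lemma hanging_unique:
  assumes "s \<in> hanging G W u" "s \<in> hanging G W v" "u \<in> W" "v \<in> W" "W \<subseteq> verts G"
  shows "u = v"
proof (rule ccontr)
  assume "u \<noteq> v"
  then show False
    using assms linked_avoiding_either[OF walk, of s u v] by (auto simp: hanging_def)
qed

lemma hanging_exists:
  assumes "block_verts G W" "s \<in> verts G"
  shows "\<exists>v\<in>W. s \<in> hanging G W v"
proof -
  obtain x where x: "x \<in> W" "x \<in> verts G"
    using assms(1) by (auto simp: block_verts_def nonseparable_def)
  show ?thesis
    using walk_retract[OF assms(1) x(1), of "\<lambda>_. True"] walk[OF x(2) assms(2)] by auto
qed

text \<open>The retraction of the graph onto a block. The description is proper for \<open>s\<close>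
  in \<open>verts G\<close>, because the sets \<open>hanging G W v\<close> with \<open>v\<close> in
  \<open>W\<close> partition the vertices.\<close>

definition attach :: "'a set \<Rightarrow> 'a \<Rightarrow> 'a" where
  "attach W s = (THE v. v \<in> W \<and> s \<in> hanging G W v)"

lemma attach_eqI:
  assumes "block_verts G W" "v \<in> W" "s \<in> hanging G W v"
  shows "attach W s = v"
  unfolding attach_def
  using assms hanging_unique[of s W] by (intro the_equality) (auto simp: block_verts_def nonseparable_def)

lemma attach:
  assumes "block_verts G W" "s \<in> verts G"
  shows "attach W s \<in> W" "s \<in> hanging G W (attach W s)"
  using hanging_exists[OF assms] attach_eqI[OF assms(1)] by auto

lemma attach_block:
  assumes "block_verts G W" "s \<in> W"
  shows "attach W s = s"
  using assms by (intro attach_eqI) (auto simp: block_verts_def nonseparable_def intro: hanging_self)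

text \<open>A step that leaves the part hanging at \<open>v\<close> from a vertex other than
  \<open>v\<close> can only end in \<open>v\<close>, which is attached to itself. Used in both
  directions of an edge, this shows that edges between different hanging parts lie inside the
  block.\<close>

lemma attach_edge:
  assumes W: "block_verts G W" and e: "a \<rightarrow>\<^bsub>G\<^esub> b" and ne: "attach W a \<noteq> attach W b"
  shows "attach W a = a"
proof (rule ccontr)
  let ?v = "attach W a"
  assume a: "?v \<noteq> a"
  have v: "?v \<in> W" "a \<in> hanging G W ?v" using attach[OF W, of a] e by auto
  show False
  proof (cases "b = ?v")
    case True
    then show False using attach_block[OF W, of b] v ne by simp
  next
    case False
    then have "b \<in> hanging G W ?v" using hanging_step[OF v(2) e] a by auto
    then show False using attach_eqI[OF W v(1)] ne by simp
  qed
qed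

subsection \<open>Blocks as induced subgraphs\<close>

lemma nonseparable_subgraph:
  assumes "subgraph H G" "graph H" "Digraph_Component.connected H" "\<nexists>v. cutvertex H v"
  shows "nonseparable G (verts H)"
  unfolding nonseparable_def
proof (intro conjI ballI allI impI)
  interpret H: connected_graph H
    using assms(2,3) by (simp add: connected_graph_def connected_graph_axioms_def)
  show "verts H \<subseteq> verts G" using assms(1) by blast
  fix x y v assume xy: "x \<in> verts H" "y \<in> verts H" "v \<noteq> x \<and> v \<noteq> y"
  have "linked_avoiding H v x y"
  proof (cases "v \<in> verts H")
    case True
    then show ?thesis using xy assms(4) H.cutvertex_iff[OF assms(3)] by blast
  next
    case False
    then show ?thesis using xy H.linked_avoiding_outside by blast
  qed
  then show "linked_avoiding G v x y"
    by (rule linked_avoiding_mono) (rule adj_mono[OF _ assms(1)])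
qed

lemma graph_induce: "W \<subseteq> verts G \<Longrightarrow> graph (G \<restriction> W)"
  by (meson digraph.graphI digraphI_induced induced_graph_imp_symmetric induced_induce sym_arcs)

text \<open>Nonseparability provides walks in \<open>G\<close>, which may leave \<open>W\<close>.
  \<open>walk_retract_block\<close> pulls them back into \<open>W\<close>, with a trivial predicate
  for connectedness and with avoidance of \<open>v\<close> for the absence of cutvertices.\<close>

lemma block_verts_induce:
  assumes W: "block_verts G W"
  shows "graph (G \<restriction> W)" "Digraph_Component.connected (G \<restriction> W)" "\<nexists>v. cutvertex (G \<restriction> W) v"
proof -
  have sub: "W \<subseteq> verts G" "W \<noteq> {}" and ns: "nonseparable G W"
    using W by (auto simp: block_verts_def nonseparable_def)
  show g: "graph (G \<restriction> W)" by (rule graph_induce[OF sub(1)])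
  interpret H: graph "G \<restriction> W" by fact
  show c: "Digraph_Component.connected (G \<restriction> W)"
    using sub walk_retract_block[OF W, where P = "\<lambda>_. True"] walk
    by (auto simp: H.connected_iff dominates_induce_iff subset_eq)
  have "linked_avoiding (G \<restriction> W) v x y" if "v \<in> W" "x \<in> W - {v}" "y \<in> W - {v}" for v x y
    using walk_retract_block[OF W, of x y "\<lambda>a. a \<noteq> v"] nonseparableD[OF ns, of x y v] that
    unfolding linked_avoiding_def dominates_induce_iff
    by (auto simp: conj_ac elim!: rtranclp_mono[THEN predicate2D, rotated])
  then show "\<nexists>v. cutvertex (G \<restriction> W) v"
    unfolding H.cutvertex_iff[OF c] by auto
qed

text \<open>Maximality among subgraphs becomes maximality among vertex sets. A connected subgraph
  without cutvertices has a nonseparable vertex set, hence lies in the subgraph induced by a maximal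
  such set, and that induced subgraph is itself a competitor.\<close>

lemma block_iff: "block G B \<longleftrightarrow> (\<exists>W. block_verts G W \<and> B = G \<restriction> W)"
proof
  assume "block G B"
  then have B: "subgraph B G" "graph B" "Digraph_Component.connected B" "\<nexists>v. cutvertex B v"
    and max: "\<And>H. H \<noteq> B \<Longrightarrow> subgraph B H \<Longrightarrow> subgraph H G \<Longrightarrow> graph H \<Longrightarrow>
      Digraph_Component.connected H \<Longrightarrow> \<not> (\<nexists>v. cutvertex H v)"
    unfolding block_def max_subgraph_def by blast+
  have "verts B \<noteq> {}" using B(3) graph.connected_iff[OF B(2)] by blast
  then obtain W where W: "block_verts G W" "verts B \<subseteq> W"
    using block_verts_extension[OF nonseparable_subgraph[OF B]] by blast
  have WG: "W \<subseteq> verts G" using W by (auto simp: block_verts_def nonseparable_def)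
  have "subgraph B (G \<restriction> W)"
    using B(1) W(2) by (auto simp: subgraph_def compatible_def wellformed_induce_subgraph)
      (metis subsetD wf_digraph.tail_in_verts, metis subsetD wf_digraph.head_in_verts)
  then have "G \<restriction> W = B"
    using max[of "G \<restriction> W"] block_verts_induce[OF W(1)] subgraph_induce_subgraphI[OF WG] by blast
  with W show "\<exists>W. block_verts G W \<and> B = G \<restriction> W" by blast
next
  assume "\<exists>W. block_verts G W \<and> B = G \<restriction> W"
  then obtain W where W: "block_verts G W" and B: "B = G \<restriction> W" by blast
  have WG: "W \<subseteq> verts G" using W by (auto simp: block_verts_def nonseparable_def)
  show "block G B"
    unfolding block_def
  proof (rule max_subgraphI, unfold B)
    show "graph (G \<restriction> W) \<and> Digraph_Component.connected (G \<restriction> W) \<and> (\<nexists>v. cutvertex (G \<restriction> W) v)"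
      using block_verts_induce[OF W] by blast
    show "subgraph (G \<restriction> W) G" by (rule subgraph_induce_subgraphI[OF WG])
    fix H assume ne: "G \<restriction> W \<noteq> H" and sub: "subgraph (G \<restriction> W) H" "subgraph H G"
    show "\<not> (graph H \<and> Digraph_Component.connected H \<and> (\<nexists>v. cutvertex H v))"
    proof
      assume "graph H \<and> Digraph_Component.connected H \<and> (\<nexists>v. cutvertex H v)"
      then have "nonseparable G (verts H)"
        using nonseparable_subgraph[OF sub(2)] by blast
      moreover have "W \<subseteq> verts H" using subgraph_imp_subverts[OF sub(1)] by simp
      ultimately have "verts H = W" using W by (auto simp: block_verts_def)
      then have "subgraph H (G \<restriction> W)" using subgraph_induce_subgraphI2[OF sub(2)] by simp
      with sub(1) have "G \<restriction> W = H"
        by (intro pre_digraph.equality) (auto simp: subgraph_def compatible_def)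
      with ne show False by contradiction
    qed
  qed
qed

end

subsection \<open>Automorphisms\<close>

lemma graph_iso_refl: "graph_iso (\<lambda>x. x) H H"
  by (simp add: graph_iso_def bij_betw_def)

lemma graph_iso_comp:
  assumes "graph_iso f H K" "graph_iso g K L"
  shows "graph_iso (g \<circ> f) H L"
  using assms unfolding graph_iso_def
  by (auto intro: bij_betw_trans) (metis bij_betwE)+

lemma graph_iso_inv:
  assumes "graph_iso f H K"
  shows "graph_iso (inv_into (verts H) f) K H"
proof -
  let ?g = "inv_into (verts H) f"
  have b: "bij_betw f (verts H) (verts K)"
    and e: "\<And>u v. u \<in> verts H \<Longrightarrow> v \<in> verts H \<Longrightarrow> u \<rightarrow>\<^bsub>H\<^esub> v \<longleftrightarrow> f u \<rightarrow>\<^bsub>K\<^esub> f v"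
    using assms by (auto simp: graph_iso_def)
  have g: "bij_betw ?g (verts K) (verts H)" by (rule bij_betw_inv_into[OF b])
  have "u \<rightarrow>\<^bsub>K\<^esub> v \<longleftrightarrow> ?g u \<rightarrow>\<^bsub>H\<^esub> ?g v" if "u \<in> verts K" "v \<in> verts K" for u v
    using e[of "?g u" "?g v"] bij_betw_inv_into_right[OF b] bij_betwE[OF g] that by simp
  with g show ?thesis by (simp add: graph_iso_def)
qed

context graph begin

lemma aut_in_verts: "graph_aut G f \<Longrightarrow> x \<in> verts G \<Longrightarrow> f x \<in> verts G"
  by (auto simp: graph_iso_def bij_betw_def)

lemma aut_inj: "graph_aut G f \<Longrightarrow> x \<in> verts G \<Longrightarrow> y \<in> verts G \<Longrightarrow> f x = f y \<longleftrightarrow> x = y"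
  by (auto simp: graph_iso_def bij_betw_def inj_on_def)

lemma aut_image: "graph_aut G f \<Longrightarrow> f ` verts G = verts G"
  by (auto simp: graph_iso_def bij_betw_def)

lemma aut_dominates: "graph_aut G f \<Longrightarrow> x \<rightarrow>\<^bsub>G\<^esub> y \<Longrightarrow> f x \<rightarrow>\<^bsub>G\<^esub> f y"
  unfolding graph_iso_def by (metis adj_in_verts)

lemma aut_obtain_inverse:
  assumes "graph_aut G f"
  obtains g where "graph_aut G g" "\<And>x. x \<in> verts G \<Longrightarrow> g (f x) = x" "\<And>x. x \<in> verts G \<Longrightarrow> f (g x) = x"
  using that[OF graph_iso_inv[OF assms]] assms
  by (auto simp: graph_iso_def bij_betw_def f_inv_into_f)

lemma aut_linked_avoiding:
  assumes f: "graph_aut G f" and "v \<in> verts G" and "linked_avoiding G v x y"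
  shows "linked_avoiding G (f v) (f x) (f y)"
  using assms(3) unfolding linked_avoiding_def[of G v]
proof (induct rule: rtranclp_induct)
  case base then show ?case by simp
next
  case (step y z)
  then have "linked_avoiding G (f v) (f y) (f z)"
    using aut_dominates[OF f] aut_inj[OF f] \<open>v \<in> verts G\<close>
    by (intro linked_avoiding_step) (auto simp: adj_in_verts)
  with step(3) show ?case by (rule linked_avoiding_trans)
qed

lemma aut_linked_avoiding_iff:
  assumes f: "graph_aut G f" and "v \<in> verts G" "x \<in> verts G" "y \<in> verts G"
  shows "linked_avoiding G (f v) (f x) (f y) \<longleftrightarrow> linked_avoiding G v x y"
proof -
  obtain g where g: "graph_aut G g" "\<And>x. x \<in> verts G \<Longrightarrow> g (f x) = x"
    using aut_obtain_inverse[OF f] by metis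
  show ?thesis
    using aut_linked_avoiding[OF f, of v x y] aut_linked_avoiding[OF g(1), of "f v" "f x" "f y"]
      assms g(2) aut_in_verts[OF f] by auto
qed

lemma aut_hanging:
  assumes f: "graph_aut G f" and "W \<subseteq> verts G" "v \<in> verts G" "z \<in> hanging G W v"
  shows "f z \<in> hanging G (f ` W) (f v)"
proof -
  have z: "z \<in> verts G" "\<And>w. w \<in> W - {v} \<Longrightarrow> \<not> linked_avoiding G v z w"
    using assms(4) by (auto simp: hanging_def)
  have "\<not> linked_avoiding G (f v) (f z) (f w)" if "w \<in> W" "f w \<noteq> f v" for w
    using z(2)[of w] aut_linked_avoiding_iff[OF f assms(3) z(1)] assms(2) that by blast
  then show ?thesis using aut_in_verts[OF f z(1)] by (auto simp: hanging_def)
qed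

subsection \<open>The center\<close>

definition gdist :: "'a \<Rightarrow> 'a \<Rightarrow> nat" where
  "gdist x y = (LEAST n. (dominates G ^^ n) x y)"

definition ecc :: "'a \<Rightarrow> nat" where
  "ecc x = Max (gdist x ` verts G)"

definition center :: "'a set" where
  "center = {x \<in> verts G. \<forall>y\<in>verts G. ecc x \<le> ecc y}"

lemma center_nonempty: "verts G \<noteq> {} \<Longrightarrow> center \<noteq> {}"
  using arg_min_if_finite(1)[of "verts G" ecc] arg_min_least[of "verts G" _ ecc]
  by (auto simp: center_def)

text \<open>The walk is split at its first visit to \<open>v\<close>. The lengths are recorded so
  that the split applies to shortest walks.\<close>

lemma walk_through:
  assumes "(dominates G ^^ n) x u" "\<not> linked_avoiding G v x u"
  shows "\<exists>k m. k + m = n \<and> (dominates G ^^ k) x v \<and> (dominates G ^^ m) v u"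
  using assms
proof (induct n arbitrary: x)
  case 0 then show ?case by simp
next
  case (Suc n)
  from Suc.prems(1) obtain x' where x': "x \<rightarrow>\<^bsub>G\<^esub> x'" "(dominates G ^^ n) x' u"
    by (elim relpowp_Suc_E2)
  show ?case
  proof (cases "x = v")
    case True
    with Suc.prems(1) have "0 + Suc n = Suc n \<and> (dominates G ^^ 0) x v \<and> (dominates G ^^ Suc n) v u"
      by simp
    then show ?thesis by blast
  next
    case xv: False
    show ?thesis
    proof (cases "x' = v")
      case True
      with x' have "1 + n = Suc n \<and> (dominates G ^^ 1) x v \<and> (dominates G ^^ n) v u"
        by (auto simp: relpowp_1)
      then show ?thesis by blast
    next
      case False
      then have "\<not> linked_avoiding G v x' u"
        using Suc.prems(2) x'(1) xv linked_avoiding_step linked_avoiding_trans by metis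
      from Suc.hyps[OF x'(2) this] obtain k m
        where "k + m = n" "(dominates G ^^ k) x' v" "(dominates G ^^ m) v u" by blast
      then have "Suc k + m = Suc n \<and> (dominates G ^^ Suc k) x v \<and> (dominates G ^^ m) v u"
        using relpowp_Suc_I2[of "dominates G" x x' k v] x'(1) by simp
      then show ?thesis by blast
    qed
  qed
qed

lemma aut_relpowp:
  assumes "graph_aut G f"
  shows "(dominates G ^^ n) x y \<Longrightarrow> (dominates G ^^ n) (f x) (f y)"
proof (induct n arbitrary: y)
  case (Suc n)
  from Suc.prems obtain z where "(dominates G ^^ n) x z" "z \<rightarrow>\<^bsub>G\<^esub> y"
    by (elim relpowp_Suc_E)
  then show ?case
    using Suc.hyps aut_dominates[OF assms] by (blast intro: relpowp_Suc_I)
qed simp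

lemma aut_gdist:
  assumes f: "graph_aut G f" and "x \<in> verts G" "y \<in> verts G"
  shows "gdist (f x) (f y) = gdist x y"
proof -
  obtain g where g: "graph_aut G g" "\<And>x. x \<in> verts G \<Longrightarrow> g (f x) = x"
    using aut_obtain_inverse[OF f] by metis
  have "(dominates G ^^ n) (f x) (f y) \<longleftrightarrow> (dominates G ^^ n) x y" for n
    using aut_relpowp[OF f, of n x y] aut_relpowp[OF g(1), of n "f x" "f y"] assms g(2) by auto
  then show ?thesis by (simp add: gdist_def)
qed

lemma aut_center:
  assumes f: "graph_aut G f" and x: "x \<in> center"
  shows "f x \<in> center"
proof -
  have xV: "x \<in> verts G" using x by (simp add: center_def)
  have "gdist (f x) ` verts G = gdist (f x) ` (f ` verts G)" by (simp add: aut_image[OF f])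
  also have "\<dots> = gdist x ` verts G"
    unfolding image_image by (rule image_cong) (auto simp: aut_gdist[OF f xV])
  finally have "ecc (f x) = ecc x" by (simp add: ecc_def)
  then show ?thesis using x aut_in_verts[OF f xV] by (simp add: center_def)
qed

end

context connected_graph begin

lemma gdist_walk: "x \<in> verts G \<Longrightarrow> y \<in> verts G \<Longrightarrow> (dominates G ^^ gdist x y) x y"
  unfolding gdist_def using walk[of x y] rtranclp_imp_relpowp[of "dominates G" x y]
  by (auto intro: LeastI_ex)

text \<open>The reverse triangle inequality at a separating vertex: a shortest walk from
  \<open>x\<close> to \<open>u\<close> has to pass through \<open>v\<close>.\<close>

lemma gdist_cut:
  assumes "x \<in> verts G" "u \<in> verts G" "\<not> linked_avoiding G v x u"
  shows "gdist x v + gdist v u \<le> gdist x u"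
proof -
  obtain k m where "k + m = gdist x u" "(dominates G ^^ k) x v" "(dominates G ^^ m) v u"
    using walk_through[OF gdist_walk[OF assms(1,2)] assms(3)] by blast
  moreover from this(2,3) have "gdist x v \<le> k" "gdist v u \<le> m"
    by (auto simp: gdist_def intro: Least_le)
  ultimately show ?thesis by linarith
qed

text \<open>
  If \<open>v\<close> separated two central vertices, then one of them would be separated by \<open>v\<close> from a
  vertex farthest from \<open>v\<close> and thus have larger eccentricity than \<open>v\<close>.
\<close>

lemma nonseparable_center: "nonseparable G center"
  unfolding nonseparable_def
proof (intro conjI ballI allI impI)
  show "center \<subseteq> verts G" by (auto simp: center_def)
  fix x y v assume xy: "x \<in> center" "y \<in> center" and v: "v \<noteq> x \<and> v \<noteq> y"
  have xyV: "x \<in> verts G" "y \<in> verts G" using xy by (auto simp: center_def)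
  show "linked_avoiding G v x y"
  proof (cases "v \<in> verts G")
    case False
    then show ?thesis using linked_avoiding_outside xyV by blast
  next
    case True
    have "ecc v \<in> gdist v ` verts G"
      unfolding ecc_def using True by (intro Max_in) auto
    then obtain u where u: "u \<in> verts G" "ecc v = gdist v u" by blast
    have far: "linked_avoiding G v z u" if z: "z \<in> center" "z \<noteq> v" for z
    proof (rule ccontr)
      assume n: "\<not> linked_avoiding G v z u"
      have zV: "z \<in> verts G" using z by (simp add: center_def)
      have "gdist z v \<noteq> 0"
      proof
        assume "gdist z v = 0"
        then show False using gdist_walk[OF zV True] z(2) by simp
      qed
      moreover have "gdist z u \<le> ecc z" unfolding ecc_def using u by (intro Max_ge) auto
      moreover have "ecc z \<le> ecc v" using z True by (simp add: center_def)
      ultimately show False using gdist_cut[OF zV u(1) n] u(2) by linarith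
    qed
    show ?thesis
      using far[OF xy(1)] linked_avoiding_sym[OF far[OF xy(2)]] v by (auto dest: linked_avoiding_trans)
  qed
qed

section \<open>Action of automorphisms on blocks\<close>

lemma aut_nonseparable:
  assumes f: "graph_aut G f" and W: "nonseparable G W"
  shows "nonseparable G (f ` W)"
  unfolding nonseparable_def
proof (intro conjI ballI allI impI)
  have WV: "W \<subseteq> verts G" using W by (simp add: nonseparable_def)
  then show sub: "f ` W \<subseteq> verts G" using aut_in_verts[OF f] by blast
  fix x y v assume xy: "x \<in> f ` W" "y \<in> f ` W" and v: "v \<noteq> x \<and> v \<noteq> y"
  show "linked_avoiding G v x y"
  proof (cases "v \<in> verts G")
    \<comment> \<open>An automorphism is controlled only on \<open>verts G\<close>, so a
      \<open>v\<close> outside need not be an image of a vertex; connectedness settles this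
      case.\<close>
    case False
    then show ?thesis using linked_avoiding_outside xy sub by blast
  next
    case True
    then obtain u where u: "u \<in> verts G" "v = f u" using aut_image[OF f] by blast
    from xy obtain x' y' where "x' \<in> W" "x = f x'" "y' \<in> W" "y = f y'" by blast
    then show ?thesis
      using u v nonseparableD[OF W, of x' y' u] aut_linked_avoiding[OF f u(1), of x' y'] by blast
  qed
qed

lemma aut_block_verts:
  assumes f: "graph_aut G f" and W: "block_verts G W"
  shows "block_verts G (f ` W)"
  unfolding block_verts_def
proof (intro conjI allI impI)
  have WV: "W \<subseteq> verts G" using W by (auto simp: nonseparable_def block_verts_def)
  show "f ` W \<noteq> {}" "nonseparable G (f ` W)"
    using W aut_nonseparable[OF f] by (auto simp: block_verts_def)
  fix W' assume W': "nonseparable G W' \<and> f ` W \<subseteq> W'"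
  obtain g where g: "graph_aut G g" "\<And>x. x \<in> verts G \<Longrightarrow> g (f x) = x"
    "\<And>x. x \<in> verts G \<Longrightarrow> f (g x) = x"
    using aut_obtain_inverse[OF f] by metis
  have "W \<subseteq> g ` W'"
  proof
    fix w assume "w \<in> W"
    then have "f w \<in> W'" "w = g (f w)" using W' WV g(2) by auto
    then show "w \<in> g ` W'" by blast
  qed
  then have "g ` W' = W"
    using W W' aut_nonseparable[OF g(1)] by (auto simp: block_verts_def)
  moreover have "f ` g ` W' = W'"
    using W' g(3) by (force simp: nonseparable_def image_iff subset_eq)
  ultimately show "W' = f ` W" by simp
qed

lemma aut_attach:
  assumes f: "graph_aut G f" and W: "block_verts G W" "f ` W = W" and z: "z \<in> verts G"
  shows "attach W (f z) = f (attach W z)"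
proof -
  have "W \<subseteq> verts G" using W by (auto simp: nonseparable_def block_verts_def)
  with attach[OF W(1) z] W(2) aut_hanging[OF f, of W "attach W z" z]
  show ?thesis by (intro attach_eqI[OF W(1)]) auto
qed

lemma aut_fixes_vertex_or_block:
  assumes f: "graph_aut G f"
  shows "(\<exists>v\<in>verts G. f v = v) \<or> (\<exists>W. block_verts G W \<and> f ` W = W)"
proof -
  have ne: "center \<noteq> {}" using conn connected_iff center_nonempty by blast
  then obtain x where x: "x \<in> center" "x \<in> verts G" by (auto simp: center_def)
  obtain W where W: "block_verts G W" "center \<subseteq> W"
    using block_verts_extension[OF nonseparable_center ne] by blast
  show ?thesis
  proof (cases "f x = x")
    case True
    with x show ?thesis by blast
  next
    case False
    \<comment> \<open>If a central vertex \<open>x\<close> is moved, then \<open>f x\<close> and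
      \<open>f (f x)\<close> are two distinct vertices common to \<open>W\<close> and its image:
      they are central, and they are the images of the central vertices \<open>x\<close> and
      \<open>f x\<close>. Blocks sharing two vertices coincide.\<close>
    have c: "f x \<in> center" "f (f x) \<in> center" using x aut_center[OF f] by blast+
    have "f (f x) \<noteq> f x" using False x c aut_inj[OF f] by (auto simp: center_def)
    then have "f x \<in> W" "f x \<in> f ` W" "f (f x) \<in> W - {f x}" "f (f x) \<in> f ` W - {f x}"
      using c x W(2) by auto
    then have "W = f ` W"
      using linked_avoiding_refl by (rule block_verts_eqI[OF W(1) aut_block_verts[OF f W(1)]])
    with W(1) show ?thesis by metis
  qed
qed

subsection \<open>Blockbranches\<close>

abbreviation branch :: "'a \<Rightarrow> 'a \<Rightarrow> ('a, 'b) pre_digraph" where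
  "branch v x \<equiv> G \<restriction> insert v {y. linked_avoiding G v x y}"

lemma blockbranches_eq: "blockbranches G v = branch v ` (verts G - {v})"
proof -
  interpret D: wf_digraph "del_vert v" by (rule wf_digraph_del_vert)
  have "D.scc_of x = {y. linked_avoiding G v x y}" if x: "x \<in> verts G - {v}" for x
  proof -
    have "y \<rightarrow>\<^sup>*\<^bsub>del_vert v\<^esub> x" if "linked_avoiding G v x y" for y
    proof -
      have "y \<in> verts G - {v}"
        using linked_avoiding_in_verts[OF that] x that by auto
      then show ?thesis using linked_avoiding_sym[OF that] by (simp add: reachable_del_vert_iff)
    qed
    then show ?thesis using x by (auto simp: D.scc_of_def reachable_del_vert_iff)
  qed
  then show ?thesis
    unfolding blockbranches_def D.sccs_verts_conv_scc_of by (auto simp: verts_del_vert)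
qed

lemma subgraph_induce_iff: "subgraph (G \<restriction> A) (G \<restriction> B) \<longleftrightarrow> A \<subseteq> B"
  by (auto simp: subgraph_def compatible_def wellformed_induce_subgraph)

text \<open>The nontrivial blockbranches of the block at \<open>v\<close> come from the components
  of \<open>G - v\<close> that miss the rest of \<open>W\<close>; together with \<open>v\<close>
  these components make up \<open>hanging G W v\<close>.\<close>

lemma X_set_eq:
  assumes W: "block_verts G W" and S: "S \<subseteq> verts G"
  shows "X_set G S (G \<restriction> W) = {v \<in> W. S \<inter> hanging G W v \<noteq> {}}"
proof -
  have WV: "W \<subseteq> verts G" and ns: "nonseparable G W"
    using W by (auto simp: nonseparable_def block_verts_def)
  have "(\<exists>H\<in>blockbranches_of_block G (G \<restriction> W) v. S \<inter> verts H \<noteq> {}) \<longleftrightarrow> S \<inter> hanging G W v \<noteq> {}"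
    if v: "v \<in> W" for v
  proof
    assume "\<exists>H\<in>blockbranches_of_block G (G \<restriction> W) v. S \<inter> verts H \<noteq> {}"
    then consider "v \<in> S" | x s where "x \<in> verts G - {v}" "\<not> subgraph (G \<restriction> W) (branch v x)"
        "s \<in> S" "s \<noteq> v" "linked_avoiding G v x s"
      by (auto simp: blockbranches_of_block_def blockbranches_eq)
    then show "S \<inter> hanging G W v \<noteq> {}"
    proof cases
      case 1
      then show ?thesis using hanging_self[of v W] S by blast
    next
      case 2
      then obtain w where w: "w \<in> W" "w \<noteq> v" "\<not> linked_avoiding G v x w"
        unfolding subgraph_induce_iff by blast
      \<comment> \<open>A branch fails to contain the block as soon as it misses a single
        \<open>w\<close>. Since \<open>W - {v}\<close> is linked off \<open>v\<close>, it then
        misses all of \<open>W - {v}\<close>.\<close>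
      have "\<not> linked_avoiding G v s w'" if "w' \<in> W - {v}" for w'
      proof
        assume "linked_avoiding G v s w'"
        also have "linked_avoiding G v w' w" using nonseparableD[OF ns] that w by auto
        finally show False using w(3) linked_avoiding_trans[OF 2(5)] by blast
      qed
      then show ?thesis using 2 S by (auto simp: hanging_def)
    qed
  next
    assume "S \<inter> hanging G W v \<noteq> {}"
    then obtain s where s: "s \<in> S" "s \<in> hanging G W v" by blast
    show "\<exists>H\<in>blockbranches_of_block G (G \<restriction> W) v. S \<inter> verts H \<noteq> {}"
    proof (cases "s = v")
      case True
      then show ?thesis using s by (auto simp: blockbranches_of_block_def)
    next
      case False
      have sV: "s \<in> verts G" and vV: "v \<in> verts G" using s S v WV by auto
      \<comment> \<open>The block is not just \<open>{v}\<close>: as \<open>s\<close> differs from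
        \<open>v\<close>, there is an edge at \<open>v\<close>, and its two ends would form a larger
        nonseparable set.\<close>
      obtain w where w: "w \<in> W" "w \<noteq> v"
      proof (rule ccontr)
        assume "\<not> thesis"
        with that v have "W = {v}" by blast
        obtain a where a: "v \<rightarrow>\<^bsub>G\<^esub> a"
          using walk[OF vV sV] False by (auto elim: converse_rtranclpE)
        then have "a \<noteq> v" using adj_not_same by blast
        moreover have "W \<subseteq> {v, a}" using \<open>W = {v}\<close> by simp
        then have "{v, a} = W" using W nonseparable_edge[OF a] by (simp add: block_verts_def)
        ultimately show False using \<open>W = {v}\<close> by blast
      qed
      have n: "\<not> linked_avoiding G v s w" using s(2) w by (auto simp: hanging_def)
      have "cutvertex G v"
        unfolding cutvertex_iff[OF conn] using n w sV vV False WV by blast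
      moreover have "\<not> subgraph (G \<restriction> W) (branch v s)"
        unfolding subgraph_induce_iff using n w by blast
      ultimately have "branch v s \<in> blockbranches_of_block G (G \<restriction> W) v"
        using sV False by (auto simp: blockbranches_of_block_def blockbranches_eq)
      then show ?thesis using s(1) by (intro bexI[of _ "branch v s"]) auto
    qed
  qed
  then show ?thesis by (auto simp: X_set_def)
qed

text \<open>Some fixed \<open>s\<close> in \<open>S\<close> is attached at \<open>u\<close>. An
  automorphism preserving \<open>W\<close> commutes with \<open>attach W\<close>, so it fixes
  \<open>u\<close> as well.\<close>

lemma aut_fixes_X_set:
  assumes f: "graph_aut G f" "\<And>s. s \<in> S \<Longrightarrow> f s = s" and W: "block_verts G W" "f ` W = W"
    and "S \<subseteq> verts G" "u \<in> X_set G S (G \<restriction> W)"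
  shows "f u = u"
proof -
  from assms(6) obtain s where s: "u \<in> W" "s \<in> S" "s \<in> hanging G W u"
    by (auto simp: X_set_eq[OF W(1) assms(5)])
  then have "attach W s = u" using attach_eqI[OF W(1)] by blast
  then show ?thesis using aut_attach[OF f(1) W, of s] f(2) s assms(5) by auto
qed

lemma aut_branch_iso:
  assumes f: "graph_aut G f" and v: "v \<in> verts G" "f v = v" and a: "a \<in> verts G"
  shows "graph_iso f (branch v a) (branch v (f a))"
proof -
  let ?A = "insert v {y. linked_avoiding G v a y}"
    and ?B = "insert v {y. linked_avoiding G v (f a) y}"
  have AV: "?A \<subseteq> verts G" using linked_avoiding_in_verts a v by blast
  have "f ` ?A = ?B"
  proof
    show "f ` ?A \<subseteq> ?B" using aut_linked_avoiding[OF f v(1)] v by auto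
    show "?B \<subseteq> f ` ?A"
    proof
      fix y assume y: "y \<in> ?B"
      then have "y \<in> verts G" using linked_avoiding_in_verts aut_in_verts[OF f a] v by blast
      then obtain x where x: "x \<in> verts G" "y = f x" using aut_image[OF f] by blast
      then have "x \<in> ?A"
        using y aut_linked_avoiding_iff[OF f v(1) a x(1)] aut_inj[OF f x(1) v(1)] v(2) by auto
      with x show "y \<in> f ` ?A" by blast
    qed
  qed
  moreover have "inj_on f ?A"
    using f AV by (meson bij_betw_imp_inj_on graph_iso_def inj_on_subset)
  moreover have "x \<rightarrow>\<^bsub>G\<^esub> y \<longleftrightarrow> f x \<rightarrow>\<^bsub>G\<^esub> f y" if "x \<in> ?A" "y \<in> ?A" for x y
    using f that AV unfolding graph_iso_def by blast
  ultimately show ?thesis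
    unfolding graph_iso_def bij_betw_def induce_subgraph_verts dominates_induce_iff by blast
qed

text \<open>Two different components of \<open>G - v\<close> are exchanged along
  \<open>\<phi>\<close> and its inverse, and everything else stays in place. Edges are respected
  because each component is joined to the rest only through \<open>v\<close>, which
  \<open>\<phi>\<close> fixes.\<close>

lemma branch_swap:
  assumes \<phi>: "graph_iso \<phi> (branch v a) (branch v b)" "\<phi> v = v"
    and ab: "a \<in> verts G - {v}" "b \<in> verts G - {v}" "v \<in> verts G" "\<not> linked_avoiding G v a b"
  obtains g where "graph_aut G g" "g a \<noteq> a"
    "\<And>z. \<not> linked_avoiding G v a z \<Longrightarrow> \<not> linked_avoiding G v b z \<Longrightarrow> g z = z"
proof -
  define A where "A = {y. linked_avoiding G v a y}"
  define B where "B = {y. linked_avoiding G v b y}"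
  define \<psi> where "\<psi> = inv_into (insert v A) \<phi>"
  define g where "g z = (if z \<in> A then \<phi> z else if z \<in> B then \<psi> z else z)" for z
  have vA: "v \<notin> A" "v \<notin> B" using ab by (auto simp: A_def B_def)
  have AV: "A \<subseteq> verts G" "B \<subseteq> verts G"
    using linked_avoiding_in_verts ab by (auto simp: A_def B_def)
  have disj: "A \<inter> B = {}"
    using ab(4) linked_avoiding_sym linked_avoiding_trans by (fastforce simp: A_def B_def)
  have \<psi>: "graph_iso \<psi> (branch v b) (branch v a)"
    using graph_iso_inv[OF \<phi>(1)] by (simp add: \<psi>_def A_def)
  have bij: "bij_betw \<phi> (insert v A) (insert v B)"
    using \<phi>(1) by (simp add: graph_iso_def A_def B_def)
  have \<phi>A: "\<phi> x \<in> B" if "x \<in> A" for x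
  proof -
    have "\<phi> x \<in> insert v B" using bij that by (auto dest: bij_betwE)
    moreover have "\<phi> x \<noteq> \<phi> v"
      using bij that vA by (auto simp: bij_betw_def inj_on_def)
    ultimately show ?thesis using \<phi>(2) by auto
  qed
  have \<psi>\<phi>: "\<psi> (\<phi> x) = x" if "x \<in> insert v A" for x
    using bij that unfolding \<psi>_def by (rule bij_betw_inv_into_left)
  have \<phi>\<psi>: "\<phi> (\<psi> x) = x" if "x \<in> insert v B" for x
    using bij that unfolding \<psi>_def by (rule bij_betw_inv_into_right)
  have \<psi>v: "\<psi> v = v" using \<psi>\<phi>[of v] \<phi>(2) by simp
  have \<psi>B: "\<psi> x \<in> A" if "x \<in> B" for x
  proof -
    have "\<psi> x \<in> insert v A"
      using bij_betwE[OF bij_betw_inv_into[OF bij]] that by (auto simp: \<psi>_def)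
    moreover have "\<psi> x \<noteq> v" using \<phi>\<psi>[of x] \<phi>(2) that vA by auto
    ultimately show ?thesis by blast
  qed
  have gA: "g x = \<phi> x" if "x \<in> insert v A" for x using that \<phi>(2) vA by (auto simp: g_def)
  have gB: "g x = \<psi> x" if "x \<in> insert v B" for x using that \<psi>v vA disj by (auto simp: g_def)
  \<comment> \<open>As \<open>g\<close> is an involution, bijectivity and the reflection of edges
    follow from the preservation of vertices and edges.\<close>
  have gg: "g (g x) = x" for x
  proof -
    consider "x \<in> A" | "x \<in> B" | "x \<notin> A" "x \<notin> B" by blast
    then show ?thesis
    proof cases
      case 1 then show ?thesis using gA gB \<phi>A \<psi>\<phi> by simp
    next
      case 2 then show ?thesis using gA gB \<psi>B \<phi>\<psi> by simp
    next
      case 3 then show ?thesis by (simp add: g_def)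
    qed
  qed
  have gV: "g x \<in> verts G" if "x \<in> verts G" for x
    using that \<phi>A \<psi>B AV by (auto simp: g_def)
  have closed: "(x \<in> A \<longrightarrow> y \<in> insert v A) \<and> (x \<in> B \<longrightarrow> y \<in> insert v B)"
    if "x \<rightarrow>\<^bsub>G\<^esub> y" for x y
  proof (cases "x = v \<or> y = v")
    case True
    then show ?thesis using vA by auto
  next
    case False
    then have "linked_avoiding G v x y" using that by (auto intro: linked_avoiding_step)
    then show ?thesis by (auto simp: A_def B_def dest: linked_avoiding_trans)
  qed
  have edge: "g x \<rightarrow>\<^bsub>G\<^esub> g y" if e: "x \<rightarrow>\<^bsub>G\<^esub> y" for x y
  proof -
    \<comment> \<open>The vertex \<open>v\<close> is counted with both components, so edges at
      \<open>v\<close> into \<open>A\<close> or \<open>B\<close> fall under the first two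
      cases.\<close>
    consider "x \<in> insert v A" "y \<in> insert v A" | "x \<in> insert v B" "y \<in> insert v B"
      | "x \<notin> A \<union> B" "y \<notin> A \<union> B"
      using closed[OF e] closed[OF graph_symmetric[OF e]] by auto
    then show ?thesis
    proof cases
      case 1
      then have "\<phi> x \<rightarrow>\<^bsub>branch v b\<^esub> \<phi> y"
        using \<phi>(1) e by (auto simp: graph_iso_def A_def dominates_induce_iff)
      then show ?thesis using 1 gA by (auto simp: dominates_induce_iff)
    next
      case 2
      then have "\<psi> x \<rightarrow>\<^bsub>branch v a\<^esub> \<psi> y"
        using \<psi> e by (auto simp: graph_iso_def B_def dominates_induce_iff)
      then show ?thesis using 2 gB by (auto simp: dominates_induce_iff)
    next
      case 3
      then show ?thesis using e by (simp add: g_def)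
    qed
  qed
  have "bij_betw g (verts G) (verts G)"
    by (rule bij_betw_byWitness[where f' = g]) (auto simp: gg gV)
  moreover have "x \<rightarrow>\<^bsub>G\<^esub> y \<longleftrightarrow> g x \<rightarrow>\<^bsub>G\<^esub> g y" for x y
    using edge[of x y] edge[of "g x" "g y"] by (auto simp: gg)
  ultimately have "graph_aut G g" by (simp add: graph_iso_def)
  moreover have "a \<in> A" by (simp add: A_def)
  then have "g a \<noteq> a" using gA \<phi>A disj by fastforce
  moreover have "g z = z" if "\<not> linked_avoiding G v a z" "\<not> linked_avoiding G v b z" for z
    using that by (simp add: g_def A_def B_def)
  ultimately show thesis by (rule that)
qed

subsection \<open>The characterization\<close>

lemma determining_imp_block_determining:
  assumes S: "determining_set G S" and W: "block_verts G W"
  shows "block_determining_set G (G \<restriction> W) (X_set G S (G \<restriction> W))"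
  unfolding block_determining_set_def induce_subgraph_verts
proof (intro conjI allI impI)
  let ?X = "X_set G S (G \<restriction> W)"
  have SV: "S \<subseteq> verts G" using S by (simp add: determining_set_def)
  have WV: "W \<subseteq> verts G" using W by (auto simp: nonseparable_def block_verts_def)
  show XW: "?X \<subseteq> W" by (auto simp: X_set_def)
  fix f assume "graph_aut G f \<and> f ` W = W \<and> (\<forall>u\<in>?X. f u = u)"
  then have f: "graph_aut G f" and fW: "f ` W = W" and fX: "\<And>u. u \<in> ?X \<Longrightarrow> f u = u" by auto
  \<comment> \<open>On the parts hanging at vertices of \<open>X_set\<close> this is the identity,
    elsewhere it is \<open>f\<close>. Every \<open>s\<close> in \<open>S\<close> is attached at a
    vertex of \<open>X_set\<close>, so \<open>g\<close> fixes \<open>S\<close>.\<close>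
  define g where "g z = (if attach W z \<in> ?X then z else f z)" for z
  have ag: "attach W (g z) = f (attach W z)" if "z \<in> verts G" for z
    using aut_attach[OF f W fW that] fX by (simp add: g_def)
  have gV: "g z \<in> verts G" if "z \<in> verts G" for z
    using that aut_in_verts[OF f] by (simp add: g_def)
  have aV: "attach W z \<in> verts G" if "z \<in> verts G" for z
    using attach(1)[OF W that] WV by blast
  \<comment> \<open>By \<open>ag\<close>, \<open>g\<close> acts on attachment vertices as the
    injective \<open>f\<close> does. Equal values thus come from the same hanging part, where a
    single clause of the definition of \<open>g\<close> applies.\<close>
  have inj: "inj_on g (verts G)"
  proof
    fix x y assume xy: "x \<in> verts G" "y \<in> verts G" "g x = g y"
    then have "attach W x = attach W y"
      using ag[of x] ag[of y] aut_inj[OF f aV aV] by simp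
    with xy show "x = y" using aut_inj[OF f] by (auto simp: g_def split: if_splits)
  qed
  \<comment> \<open>This concerns pairs on which \<open>g\<close> uses different clauses. If
    \<open>x\<close> lies in the block, then \<open>x\<close> is in \<open>X_set\<close> and
    \<open>f\<close> fixes it, so \<open>g\<close> agrees with \<open>f\<close> on both vertices.
    Otherwise \<open>attach_edge\<close> excludes an edge on either side.\<close>
  have mixed: "x \<rightarrow>\<^bsub>G\<^esub> y \<longleftrightarrow> g x \<rightarrow>\<^bsub>G\<^esub> g y"
    if x: "x \<in> verts G" "attach W x \<in> ?X" and y: "y \<in> verts G" "attach W y \<notin> ?X" for x y
  proof -
    have gx: "g x = x" and gy: "g y = f y" using that by (auto simp: g_def)
    have iff: "x \<rightarrow>\<^bsub>G\<^esub> y \<longleftrightarrow> f x \<rightarrow>\<^bsub>G\<^esub> f y" using f x y by (simp add: graph_iso_def)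
    have ne: "attach W x \<noteq> attach W y" using x y by auto
    show ?thesis
    proof (cases "attach W x = x")
      case True
      then have "f x = x" using fX x by metis
      then show ?thesis using iff gx gy by simp
    next
      case False
      have "f (attach W x) \<noteq> f (attach W y)" using aut_inj[OF f aV aV] x y ne by blast
      then have "attach W (g x) \<noteq> attach W (g y)" using ag x y by simp
      then show ?thesis
        using attach_edge[OF W, of x y] attach_edge[OF W, of "g x" "g y"] ne False gx by auto
    qed
  qed
  have iff: "x \<rightarrow>\<^bsub>G\<^esub> y \<longleftrightarrow> g x \<rightarrow>\<^bsub>G\<^esub> g y" if "x \<in> verts G" "y \<in> verts G" for x y
  proof (cases "attach W x \<in> ?X \<longleftrightarrow> attach W y \<in> ?X")
    case True
    then show ?thesis using f that by (auto simp: g_def graph_iso_def)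
  next
    case False
    then show ?thesis using mixed[of x y] mixed[of y x] that graph_symmetric by blast
  qed
  have "g ` verts G = verts G"
    using gV inj by (intro endo_inj_surj) auto
  with inj iff have "graph_aut G g" by (simp add: graph_iso_def bij_betw_def)
  moreover have "g s = s" if "s \<in> S" for s
  proof -
    have "s \<in> verts G" using that SV by blast
    then have "attach W s \<in> ?X"
      using attach[OF W] that by (auto simp: X_set_eq[OF W SV])
    then show ?thesis by (simp add: g_def)
  qed
  ultimately have gid: "\<And>z. z \<in> verts G \<Longrightarrow> g z = z"
    using S by (auto simp: determining_set_def)
  show "\<forall>b\<in>W. f b = b"
  proof
    fix b assume b: "b \<in> W"
    then show "f b = b"
      using gid[of b] fX[of b] attach_block[OF W b] WV by (cases "b \<in> ?X") (auto simp: g_def)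
  qed
qed

text \<open>Two members of one class that both miss \<open>S - {v}\<close> could be exchanged by
  \<open>branch_swap\<close>, a nontrivial automorphism fixing \<open>S\<close>. So at most one
  member misses it.\<close>

lemma determining_imp_branch_condition:
  assumes S: "determining_set G S" and v: "v \<in> verts G"
    and \<C>: "\<C> \<in> blockbranches G v // branch_iso G v"
  shows "\<exists>H\<in>\<C>. \<forall>K\<in>\<C> - {H}. verts K \<inter> (S - {v}) \<noteq> {}"
proof -
  obtain L where L: "L \<in> blockbranches G v" "\<C> = branch_iso G v `` {L}"
    using \<C> by (auto elim: quotientE)
  have LC: "L \<in> \<C>"
    using L graph_iso_refl[of L] by (auto simp: branch_iso_def)
  have unique: "H = K"
    if H: "H \<in> \<C>" "verts H \<inter> (S - {v}) = {}" and K: "K \<in> \<C>" "verts K \<inter> (S - {v}) = {}" for H K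
  proof (rule ccontr)
    assume "H \<noteq> K"
    obtain f h where fh: "graph_iso f L H" "f v = v" "graph_iso h L K" "h v = v"
      using H K L by (auto simp: branch_iso_def)
    have vL: "v \<in> verts L" using L(1) by (auto simp: blockbranches_eq)
    \<comment> \<open>The class is given as the image of its representative \<open>L\<close>, so the
      isomorphism from \<open>H\<close> to \<open>K\<close> is composed through
      \<open>L\<close>.\<close>
    let ?\<phi> = "h \<circ> inv_into (verts L) f"
    have "inj_on f (verts L)" using fh by (auto simp: graph_iso_def bij_betw_def)
    then have "inv_into (verts L) f (f v) = v" using vL by (rule inv_into_f_f)
    then have \<phi>v: "?\<phi> v = v" using fh by simp
    have \<phi>: "graph_iso ?\<phi> H K" using graph_iso_comp[OF graph_iso_inv[OF fh(1)] fh(3)] .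
    have "H \<in> blockbranches G v" "K \<in> blockbranches G v"
      using H K L by (auto simp: branch_iso_def)
    then obtain a b where ab: "a \<in> verts G - {v}" "H = branch v a" "b \<in> verts G - {v}" "K = branch v b"
      by (auto simp: blockbranches_eq)
    have "\<not> linked_avoiding G v a b"
    proof
      assume l: "linked_avoiding G v a b"
      then have "linked_avoiding G v a y \<longleftrightarrow> linked_avoiding G v b y" for y
        using linked_avoiding_trans[OF l, of y] linked_avoiding_trans[OF linked_avoiding_sym[OF l], of y]
        by blast
      with ab \<open>H \<noteq> K\<close> show False by simp
    qed
    with \<phi> \<phi>v ab v obtain g where g: "graph_aut G g" "g a \<noteq> a"
      "\<And>z. \<not> linked_avoiding G v a z \<Longrightarrow> \<not> linked_avoiding G v b z \<Longrightarrow> g z = z"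
      by (metis branch_swap)
    have "g s = s" if "s \<in> S" for s
    proof (rule g(3))
      show "\<not> linked_avoiding G v a s" using H(2) ab that by (cases "s = v") auto
      show "\<not> linked_avoiding G v b s" using K(2) ab that by (cases "s = v") auto
    qed
    with g S ab show False by (auto simp: determining_set_def)
  qed
  show ?thesis
  proof (cases "\<exists>H\<in>\<C>. verts H \<inter> (S - {v}) = {}")
    case True
    then obtain H where "H \<in> \<C>" "verts H \<inter> (S - {v}) = {}" by blast
    with unique show ?thesis by (intro bexI[of _ H]) blast+
  next
    \<comment> \<open>No member misses \<open>S - {v}\<close>, so any member can play the
      exceptional one; \<open>L\<close> shows that the class is nonempty.\<close>
    case False
    with LC show ?thesis by blast
  qed
qed

lemma determining_if_conditions:
  assumes SV: "S \<subseteq> verts G"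
    and blocks: "\<And>W. block_verts G W \<Longrightarrow> block_determining_set G (G \<restriction> W) (X_set G S (G \<restriction> W))"
    and branches: "\<And>v \<C>. cutvertex G v \<Longrightarrow> \<C> \<in> blockbranches G v // branch_iso G v \<Longrightarrow>
      \<exists>H\<in>\<C>. \<forall>K\<in>\<C> - {H}. verts K \<inter> (S - {v}) \<noteq> {}"
  shows "determining_set G S"
  unfolding determining_set_def
proof (intro conjI allI impI SV)
  fix f assume "graph_aut G f \<and> (\<forall>s\<in>S. f s = s)"
  then have f: "graph_aut G f" and fS: "\<And>s. s \<in> S \<Longrightarrow> f s = s" by auto
  have block_fixed: "f w = w" if "block_verts G W" "f ` W = W" "w \<in> W" for W w
  proof -
    have "\<forall>u\<in>X_set G S (G \<restriction> W). f u = u"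
      using aut_fixes_X_set[OF f fS that(1,2) SV] by blast
    then show ?thesis
      using blocks[OF that(1)] f that unfolding block_determining_set_def by simp
  qed
  \<comment> \<open>An automorphism fixing \<open>v\<close> cannot move a component of
    \<open>G - v\<close>. Otherwise the branches of \<open>a\<close> and \<open>f a\<close> would be
    distinct members of one class, and at most one of them is the exception in the second
    condition.\<close>
  have branch_fixed: "linked_avoiding G v a (f a)"
    if v: "v \<in> verts G" "f v = v" and a: "a \<in> verts G" "a \<noteq> v" for v a
  proof (rule ccontr)
    assume n: "\<not> linked_avoiding G v a (f a)"
    have fa: "f a \<in> verts G" "f a \<noteq> v"
      using aut_in_verts[OF f a(1)] aut_inj[OF f a(1) v(1)] v(2) a(2) by auto
    then have cut: "cutvertex G v"
      unfolding cutvertex_iff[OF conn] using v a n by blast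
    let ?H = "branch v a" and ?K = "branch v (f a)"
    have HK: "?H \<in> blockbranches G v" "?K \<in> blockbranches G v"
      using a fa by (auto simp: blockbranches_eq)
    have "?H \<noteq> ?K"
    proof
      assume "?H = ?K"
      then have "verts ?H = verts ?K" by simp
      then have "f a \<in> verts ?H" by simp
      with n fa show False by simp
    qed
    moreover have mem: "?H \<in> branch_iso G v `` {?H}" "?K \<in> branch_iso G v `` {?H}"
      using HK graph_iso_refl[of ?H] aut_branch_iso[OF f v a(1)] v(2) by (auto simp: branch_iso_def)
    moreover have "branch_iso G v `` {?H} \<in> blockbranches G v // branch_iso G v"
      using HK(1) by (rule quotientI)
    ultimately have "verts ?H \<inter> (S - {v}) \<noteq> {} \<or> verts ?K \<inter> (S - {v}) \<noteq> {}"
      using branches[OF cut, of "branch_iso G v `` {?H}"] by (metis Diff_iff singletonD)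
    then obtain s where s: "s \<in> S" "linked_avoiding G v a s \<or> linked_avoiding G v (f a) s"
      by auto
    \<comment> \<open>Both \<open>v\<close> and \<open>s\<close> are fixed, so \<open>f\<close>
      carries a link from \<open>a\<close> to \<open>s\<close> to one from \<open>f a\<close> to
      \<open>s\<close>, and conversely. The two components would share \<open>s\<close>.\<close>
    then have "linked_avoiding G v a s" "linked_avoiding G v (f a) s"
      using aut_linked_avoiding_iff[OF f v(1) a(1), of s] fS[of s] SV v(2) by auto
    then show False
      using n linked_avoiding_trans[OF _ linked_avoiding_sym] by blast
  qed
  have step: "f b = b" if v: "f v = v" and e: "v \<rightarrow>\<^bsub>G\<^esub> b" for v b
  proof -
    have V: "v \<in> verts G" "b \<in> verts G" "b \<noteq> v" using e adj_not_same by auto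
    obtain W where "block_verts G W" "{v, b} \<subseteq> W"
      by (rule block_verts_extension[OF nonseparable_edge[OF e]]) simp
    then have W: "block_verts G W" "v \<in> W" "b \<in> W" by auto
    have "f b \<noteq> v" using aut_inj[OF f V(2,1)] v V(3) by simp
    then have "W = f ` W"
      using W V v branch_fixed[OF V(1) v V(2,3)]
      by (intro block_verts_eqI[OF W(1) aut_block_verts[OF f W(1)], of v b "f b"]) force+
    then show ?thesis using block_fixed[OF W(1) _ W(3)] by simp
  qed
  \<comment> \<open>The center supplies a first fixed vertex, from which \<open>step\<close> spreads
    along walks to the whole graph.\<close>
  obtain c where c: "c \<in> verts G" "f c = c"
    using aut_fixes_vertex_or_block[OF f]
  proof
    assume "\<exists>W. block_verts G W \<and> f ` W = W"
    then obtain W where W: "block_verts G W" "f ` W = W" by blast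
    then obtain w where "w \<in> W" "w \<in> verts G" by (auto simp: block_verts_def nonseparable_def)
    with block_fixed[OF W] that show thesis by blast
  qed (use that in blast)
  show "\<forall>v\<in>verts G. f v = v"
  proof
    fix z assume "z \<in> verts G"
    from walk[OF c(1) this] show "f z = z"
      by (induct rule: rtranclp_induct) (use c(2) step in blast)+
  qed
qed

end

theorem theorem20:
  fixes G :: "('a, 'b) pre_digraph" and S :: "'a set"
  assumes "graph G" and "Digraph_Component.connected G" and "outerplanar G"
    and "S \<subseteq> verts G"
  shows "determining_set G S \<longleftrightarrow>
    (\<forall>B. block G B \<longrightarrow> block_determining_set G B (X_set G S B)) \<and>
    (\<forall>v. cutvertex G v \<longrightarrow>
       (\<forall>\<C> \<in> blockbranches G v // branch_iso G v.
          \<exists>H \<in> \<C>. \<forall>K \<in> \<C> - {H}. verts K \<inter> (S - {v}) \<noteq> {}))"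
proof -
  interpret connected_graph G
    using assms by (simp add: connected_graph_def connected_graph_axioms_def)
  show ?thesis
  proof
    assume S: "determining_set G S"
    show "(\<forall>B. block G B \<longrightarrow> block_determining_set G B (X_set G S B)) \<and>
      (\<forall>v. cutvertex G v \<longrightarrow>
         (\<forall>\<C> \<in> blockbranches G v // branch_iso G v.
            \<exists>H \<in> \<C>. \<forall>K \<in> \<C> - {H}. verts K \<inter> (S - {v}) \<noteq> {}))"
      using determining_imp_block_determining[OF S] determining_imp_branch_condition[OF S]
      by (auto simp: block_iff cutvertex_def)
  next
    assume "(\<forall>B. block G B \<longrightarrow> block_determining_set G B (X_set G S B)) \<and>
      (\<forall>v. cutvertex G v \<longrightarrow>
         (\<forall>\<C> \<in> blockbranches G v // branch_iso G v.
            \<exists>H \<in> \<C>. \<forall>K \<in> \<C> - {H}. verts K \<inter> (S - {v}) \<noteq> {}))"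
    then show "determining_set G S"
      using block_iff by (intro determining_if_conditions assms(4)) blast+
  qed
qed

end
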